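(* Let $v$ be a node with noise-free labelled samples $(\mathbf{x}_1,y_1),\dots,(\mathbf{x}_n,y_n)$, $y_i\in\{+1,-1\}$, and let $\mathcal{F}$ be a set of split rules at $v$. Suppose the labels are corrupted by symmetric label noise with rate $\eta\in[0,1]$, $\eta\neq 0.5$. Then each of the following three split criteria $C$ is noise-tolerant, i.e. satisfies $$\arg\max_{f\in\mathcal{F}} C(f)=\arg\max_{f\in\mathcal{F}} C^{\eta}(f)$$ (as sets of maximizers), where $C(f)$ is the value of the criterion on noise-free data and $C^{\eta}(f)$ its large-sample value under the noise: (i) the impurity gain based on the Gini impurity, $C=\mathrm{gain}_{\mathrm{Gini}}$; (ii) the impurity gain based on the misclassification impurity, $C=\mathrm{gain}_{\mathrm{MC}}$; (iii) the twoing rule, $C=G_{\mathrm{Twoing}}$.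
   Context: A split rule $f$ is a function of the feature vector only; it sends each sample at $v$ to the left child $v_l$ or the right child $v_r$. Let $a$ be the fraction of the samples at $v$ sent to $v_l$ (so $1-a$ go to $v_r$). Let $p,q=1-p$ be the fractions of positive and negative samples at $v$ in the noise-free data, and $p_l,q_l=1-p_l$ and $p_r,q_r=1-p_r$ the corresponding fractions among the samples at $v_l$ and $v_r$; thus $ap_l+(1-a)p_r=p$. Impurity of a node with class fractions $p,q$: Gini impurity $G_{\mathrm{Gini}}=2pq$; misclassification impurity $G_{\mathrm{MC}}=\min\{p,q\}$. For an impurity $G$ the gain of $f$ is $$\mathrm{gain}_G(f)=G(v)-\bigl(a\,G(v_l)+(1-a)\,G(v_r)\bigr).$$ The twoing criterion is $$G_{\mathrm{Twoing}}(f)=\tfrac{a(1-a)}{4}\bigl[|p_l-p_r|+|q_l-q_r|\bigr]^2.$$ Terms multiplied by a zero weight $a$ or $1-a$ are taken to be $0$ (this covers an empty child). Symmetric label noise with rate $\eta$: the noisy labels are $\tilde y_i=-y_i$ if $Z_i=1$ and $\tilde y_i=y_i$ if $Z_i=0$, where $Z_1,\dots,Z_n$ are iid Bernoulli random variables with mean $\eta$ (independent of features and true labels). The feature vectors, and hence $a$, are unchanged by the noise. The large-sample values of the noisy class fractions are the values obtained by replacing each $Z_i$ by its expectation: with $\tilde p,\tilde p_l,\tilde p_r$ the fractions of samples with $\tilde y_i=+1$ at $v,v_l,v_r$, set $p^{\eta}=E[\tilde p]$, $p_l^{\eta}=E[\tilde p_l]$, $p_r^{\eta}=E[\tilde p_r]$,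 and $q^{\eta}=1-p^{\eta}$, etc.; explicitly $p^\eta=(1-\eta)p+\eta q$, and likewise for the children. The value $C^{\eta}(f)$ is obtained from the formula for $C(f)$ by replacing $p,q,p_l,q_l,p_r,q_r$ by $p^{\eta},q^{\eta},p_l^{\eta},q_l^{\eta},p_r^{\eta},q_r^{\eta}$, keeping $a$. *)

theory Defs
  imports "HOL-Probability.Probability"
begin

text \<open>
  The node holds the samples \<open>(x i, y i)\<close>, \<open>i \<in> {1..n}\<close>, with labels in \<open>{1, -1}\<close>; sets of samples are
  given by their indices. A split rule is a predicate on feature vectors: \<open>f (x i)\<close> means that
  sample \<open>i\<close> is sent to the left child.
\<close>

definition left_child :: "nat \<Rightarrow> (nat \<Rightarrow> 'x) \<Rightarrow> ('x \<Rightarrow> bool) \<Rightarrow> nat set" where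
  "left_child n x f = {i \<in> {1..n}. f (x i)}"

definition right_child :: "nat \<Rightarrow> (nat \<Rightarrow> 'x) \<Rightarrow> ('x \<Rightarrow> bool) \<Rightarrow> nat set" where
  "right_child n x f = {i \<in> {1..n}. \<not> f (x i)}"

definition left_fraction :: "nat \<Rightarrow> (nat \<Rightarrow> 'x) \<Rightarrow> ('x \<Rightarrow> bool) \<Rightarrow> real" where
  "left_fraction n x f = real (card (left_child n x f)) / real n"

text \<open>
  For an empty child the value is \<open>0 / 0 = 0\<close>; it only enters the criteria below multiplied by a
  zero weight.
\<close>

definition pos_fraction :: "(nat \<Rightarrow> int) \<Rightarrow> nat set \<Rightarrow> real" where
  "pos_fraction y I = real (card {i \<in> I. y i = 1}) / real (card I)"

definition noisy_label :: "(nat \<Rightarrow> 'w \<Rightarrow> bool) \<Rightarrow> (nat \<Rightarrow> int) \<Rightarrow> 'w \<Rightarrow> nat \<Rightarrow> int" where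
  "noisy_label Z y \<omega> i = (if Z i \<omega> then - y i else y i)"

text \<open>
  Large-sample value of the noisy positive fraction. Only the labels are random; the samples are
  fixed, so the noise is automatically independent of features and true labels.
\<close>

definition noisy_pos_fraction ::
    "'w measure \<Rightarrow> (nat \<Rightarrow> 'w \<Rightarrow> bool) \<Rightarrow> (nat \<Rightarrow> int) \<Rightarrow> nat set \<Rightarrow> real" where
  "noisy_pos_fraction M Z y I = prob_space.expectation M (\<lambda>\<omega>. pos_fraction (noisy_label Z y \<omega>) I)"

definition symmetric_noise ::
    "'w measure \<Rightarrow> (nat \<Rightarrow> 'w \<Rightarrow> bool) \<Rightarrow> nat set \<Rightarrow> real \<Rightarrow> bool" where
  "symmetric_noise M Z I \<eta> \<longleftrightarrow>
     prob_space M \<and>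
     prob_space.indep_vars M (\<lambda>_. count_space UNIV) Z I \<and>
     (\<forall>i\<in>I. distr M (count_space UNIV) (Z i) = measure_pmf (bernoulli_pmf \<eta>))"

text \<open>Impurities as functions of the class fractions \<open>p\<close> and \<open>q\<close>.\<close>

definition gini :: "real \<Rightarrow> real \<Rightarrow> real" where
  "gini p q = 2 * p * q"

definition misclass :: "real \<Rightarrow> real \<Rightarrow> real" where
  "misclass p q = min p q"

text \<open>
  Criteria as functions of \<open>a\<close> and of the positive fractions \<open>p\<close>, \<open>p\<^sub>l\<close>, \<open>p\<^sub>r\<close>; the negative fractions
  are their complements. The twoing rule ignores \<open>p\<close>.
\<close>

definition gain :: "(real \<Rightarrow> real \<Rightarrow> real) \<Rightarrow> real \<Rightarrow> real \<Rightarrow> real \<Rightarrow> real \<Rightarrow> real" where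
  "gain G a p p\<^sub>l p\<^sub>r = G p (1 - p) - (a * G p\<^sub>l (1 - p\<^sub>l) + (1 - a) * G p\<^sub>r (1 - p\<^sub>r))"

definition twoing :: "real \<Rightarrow> real \<Rightarrow> real \<Rightarrow> real \<Rightarrow> real" where
  "twoing a p p\<^sub>l p\<^sub>r = a * (1 - a) / 4 * (\<bar>p\<^sub>l - p\<^sub>r\<bar> + \<bar>(1 - p\<^sub>l) - (1 - p\<^sub>r)\<bar>)\<^sup>2"

text \<open>
  The value of a criterion at a split rule, where \<open>P I\<close> is the positive fraction used for the set of
  samples \<open>I\<close>: either the noise-free one or the large-sample noisy one. The weight \<open>a\<close> is the same
  in both cases.
\<close>

definition criterion_value ::
    "(real \<Rightarrow> real \<Rightarrow> real \<Rightarrow> real \<Rightarrow> real) \<Rightarrow> (nat set \<Rightarrow> real) \<Rightarrow> nat \<Rightarrow> (nat \<Rightarrow> 'x) \<Rightarrow> ('x \<Rightarrow> bool) \<Rightarrow> real"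
where
  "criterion_value C P n x f =
     C (left_fraction n x f) (P {1..n}) (P (left_child n x f)) (P (right_child n x f))"

definition maximizers :: "('f \<Rightarrow> real) \<Rightarrow> 'f set \<Rightarrow> 'f set" where
  "maximizers C F = {f. is_arg_max C (\<lambda>g. g \<in> F) f}"

definition noise_tolerant ::
    "(real \<Rightarrow> real \<Rightarrow> real \<Rightarrow> real \<Rightarrow> real) \<Rightarrow> 'w measure \<Rightarrow> (nat \<Rightarrow> 'w \<Rightarrow> bool) \<Rightarrow>
     nat \<Rightarrow> (nat \<Rightarrow> 'x) \<Rightarrow> (nat \<Rightarrow> int) \<Rightarrow> ('x \<Rightarrow> bool) set \<Rightarrow> bool" where
  "noise_tolerant C M Z n x y F \<longleftrightarrow>
     maximizers (criterion_value C (pos_fraction y) n x) F =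
     maximizers (criterion_value C (noisy_pos_fraction M Z y) n x) F"

end

theory Submission imports Defs begin

text \<open>
  Symmetric noise acts on the class fractions by \<open>p \<mapsto> (1 - \<eta>) p + \<eta> (1 - p)\<close>, that is,
  \<open>2p - 1 \<mapsto> (1 - 2\<eta>) (2p - 1)\<close>. Since \<open>2 p (1 - p) = (1 - (2p - 1)\<^sup>2) / 2\<close> and
  \<open>min p (1 - p) = (1 - \<bar>2p - 1\<bar>) / 2\<close>, and the additive constants cancel in a gain, the noise
  multiplies the Gini gain and the twoing value by \<open>(1 - 2\<eta>)\<^sup>2\<close> and the misclassification gain by
  \<open>\<bar>1 - 2\<eta>\<bar>\<close>. A positive factor does not change the maximizers.
\<close>

definition flip :: "real \<Rightarrow> real \<Rightarrow> real" where
  "flip \<eta> p = (1 - \<eta>) * p + \<eta> * (1 - p)"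

text \<open>The integrand sees \<omega> only through \<open>Z i\<close>, so the integral moves to
  the Bernoulli law, a sum over two points. Integrability holds because only two values are
  taken.\<close>

lemma symmetric_noise_expectation:
  assumes "symmetric_noise M Z I \<eta>" and "i \<in> I" and "0 \<le> \<eta>" and "\<eta> \<le> 1"
  shows "integrable M (\<lambda>\<omega>. g (Z i \<omega>) :: real)"
    and "integral\<^sup>L M (\<lambda>\<omega>. g (Z i \<omega>)) = \<eta> * g True + (1 - \<eta>) * g False"
proof -
  interpret prob_space M
    using assms(1) by (simp add: symmetric_noise_def)
  have meas [measurable]: "Z i \<in> measurable M (count_space UNIV)"
    using assms(1,2) by (auto simp: symmetric_noise_def indep_vars_def)
  have distr: "distr M (count_space UNIV) (Z i) = measure_pmf (bernoulli_pmf \<eta>)"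
    using assms(1,2) by (simp add: symmetric_noise_def)
  show "integrable M (\<lambda>\<omega>. g (Z i \<omega>))"
  proof (rule integrable_const_bound[where B = "max \<bar>g True\<bar> \<bar>g False\<bar>"])
    show "AE \<omega> in M. norm (g (Z i \<omega>)) \<le> max \<bar>g True\<bar> \<bar>g False\<bar>"
      by (intro AE_I2, rename_tac \<omega>, case_tac "Z i \<omega>") simp_all
  qed measurable
  have "integral\<^sup>L M (\<lambda>\<omega>. g (Z i \<omega>)) = integral\<^sup>L (distr M (count_space UNIV) (Z i)) g"
    by (subst integral_distr) auto
  also have "\<dots> = \<eta> * g True + (1 - \<eta>) * g False"
    using assms(3,4) by (simp add: distr)
  finally show "integral\<^sup>L M (\<lambda>\<omega>. g (Z i \<omega>)) = \<eta> * g True + (1 - \<eta>) * g False" .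
qed

lemma pos_fraction_eq_sum:
  assumes "finite I"
  shows "pos_fraction y I = (\<Sum>i\<in>I. of_bool (y i = 1)) / real (card I)"
  using assms by (simp add: pos_fraction_def of_bool_def sum.If_cases Int_def)

text \<open>Linearity of expectation over the indicators of noisy positive labels. \<open>I\<close>
  must be nonempty: for an empty set the left side is 0, but
  \<open>flip \<eta> 0 = \<eta>\<close>.\<close>

lemma noisy_pos_fraction_eq_flip:
  assumes noise: "symmetric_noise M Z J \<eta>" and \<eta>: "0 \<le> \<eta>" "\<eta> \<le> 1"
    and I: "I \<subseteq> J" "finite I" "I \<noteq> {}"
    and y: "\<And>i. i \<in> I \<Longrightarrow> y i \<in> {1, -1}"
  shows "noisy_pos_fraction M Z y I = flip \<eta> (pos_fraction y I)"
proof -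
  let ?g = "\<lambda>i z. of_bool ((if z then - y i else y i) = 1) :: real"
  have "noisy_pos_fraction M Z y I = integral\<^sup>L M (\<lambda>\<omega>. \<Sum>i\<in>I. ?g i (Z i \<omega>)) / real (card I)"
    using I(2) by (simp add: noisy_pos_fraction_def pos_fraction_eq_sum noisy_label_def)
  also have "integral\<^sup>L M (\<lambda>\<omega>. \<Sum>i\<in>I. ?g i (Z i \<omega>)) = (\<Sum>i\<in>I. integral\<^sup>L M (\<lambda>\<omega>. ?g i (Z i \<omega>)))"
    using I(1) by (intro Bochner_Integration.integral_sum
        symmetric_noise_expectation(1)[OF noise _ \<eta>, where g = "?g _"]) (rule subsetD)
  also have "\<dots> = (\<Sum>i\<in>I. \<eta> * ?g i True + (1 - \<eta>) * ?g i False)"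
    using I(1) by (intro sum.cong refl
        symmetric_noise_expectation(2)[OF noise _ \<eta>, where g = "?g _"]) (rule subsetD)
  \<comment> \<open>A positive sample stays positive with probability \<open>1 - \<eta>\<close>, a
    negative one becomes positive with probability \<eta>.\<close>
  also have "\<dots> = (\<Sum>i\<in>I. \<eta> + (1 - 2 * \<eta>) * of_bool (y i = 1))"
    using y by (intro sum.cong) fastforce+
  also have "\<dots> = real (card I) * \<eta> + (1 - 2 * \<eta>) * (\<Sum>i\<in>I. of_bool (y i = 1))"
    by (simp add: sum.distrib sum_distrib_left)
  finally have "noisy_pos_fraction M Z y I = \<eta> + (1 - 2 * \<eta>) * pos_fraction y I"
    using I(2,3) by (simp add: pos_fraction_eq_sum add_divide_distrib)
  then show ?thesis
    by (simp add: flip_def algebra_simps)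
qed

lemma maximizers_scale:
  fixes C D :: "'f \<Rightarrow> real"
  assumes "c > 0" and "\<And>f. f \<in> F \<Longrightarrow> D f = c * C f"
  shows "maximizers D F = maximizers C F"
  using assms by (auto simp: maximizers_def is_arg_max_def)

text \<open>
  The hypotheses at \<open>a = 0\<close> and \<open>a = 1\<close> take care of empty children, where both fractions have
  the junk value \<open>0\<close> and are therefore not related by \<open>flip\<close>.
\<close>

lemma noise_tolerant_if_scales:
  fixes x :: "nat \<Rightarrow> 'x" and F :: "('x \<Rightarrow> bool) set"
  assumes n: "n \<ge> 1" and y: "\<And>i. i \<in> {1..n} \<Longrightarrow> y i \<in> {1, -1}"
    and \<eta>: "0 \<le> \<eta>" "\<eta> \<le> 1"
    and noise: "symmetric_noise M Z {1..n} \<eta>"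
    and c: "c > 0"
    and scale: "\<And>a p l r. C a (flip \<eta> p) (flip \<eta> l) (flip \<eta> r) = c * C a p l r"
    and left: "\<And>p l l' r. C 0 p l r = C 0 p l' r"
    and right: "\<And>p l r r'. C 1 p l r = C 1 p l r'"
  shows "noise_tolerant C M Z n x y F"
proof -
  have "criterion_value C (noisy_pos_fraction M Z y) n x f =
      c * criterion_value C (pos_fraction y) n x f" for f
  proof -
    let ?a = "left_fraction n x f" and ?L = "left_child n x f" and ?R = "right_child n x f"
    have sub: "?L \<subseteq> {1..n}" "?R \<subseteq> {1..n}"
      by (auto simp: left_child_def right_child_def)
    have flip: "noisy_pos_fraction M Z y I = flip \<eta> (pos_fraction y I)"
      if "I \<subseteq> {1..n}" "I \<noteq> {}" for I
      using that y finite_subset[OF that(1)]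
      by (intro noisy_pos_fraction_eq_flip[OF noise \<eta>]) blast+
    have root: "noisy_pos_fraction M Z y {1..n} = flip \<eta> (pos_fraction y {1..n})"
      using n by (intro flip) auto
    \<comment> \<open>The other arguments stay arbitrary, so that \<open>L\<close> and
      \<open>R\<close> can rewrite the same term in turn.\<close>
    have L: "C ?a p (noisy_pos_fraction M Z y ?L) r = C ?a p (flip \<eta> (pos_fraction y ?L)) r"
      for p r
    proof (cases "?L = {}")
      case True
      then have "?a = 0" by (simp add: left_fraction_def)
      then show ?thesis by (simp only:) (rule left)
    qed (simp add: flip[OF sub(1)])
    have R: "C ?a p l (noisy_pos_fraction M Z y ?R) = C ?a p l (flip \<eta> (pos_fraction y ?R))"
      for p l
    proof (cases "?R = {}")
      case True
      then have "?L = {1..n}" by (auto simp: left_child_def right_child_def)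
      \<comment> \<open>\<open>n \<ge> 1\<close> rules out \<open>0 / 0 = 0\<close>.\<close>
      then have "?a = 1" using n by (simp add: left_fraction_def)
      then show ?thesis by (simp only:) (rule right)
    qed (simp add: flip[OF sub(2)])
    show ?thesis
      by (simp only: criterion_value_def root L R scale)
  qed
  then show ?thesis
    unfolding noise_tolerant_def by (simp only: maximizers_scale[OF c])
qed

lemma gain_gini_flip:
  "gain gini a (flip \<eta> p) (flip \<eta> l) (flip \<eta> r) = (1 - 2 * \<eta>)\<^sup>2 * gain gini a p l r"
  by (simp add: gain_def gini_def flip_def power2_eq_square algebra_simps)

text \<open>This is \<open>min s t = (s + t - \<bar>s - t\<bar>) / 2\<close> with
  \<open>s + t = 1\<close>.\<close>

lemma misclass_complement: "misclass p (1 - p) = (1 - \<bar>2 * p - 1\<bar>) / 2"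
  by (simp add: misclass_def min_def abs_if)

text \<open>The fixed point 1/2 of the affine map \<open>flip \<eta>\<close> becomes the origin,
  where the map is multiplication by its slope.\<close>

lemma flip_centered: "2 * flip \<eta> p - 1 = (1 - 2 * \<eta>) * (2 * p - 1)"
  by (simp add: flip_def algebra_simps)

lemma gain_misclass_flip:
  "gain misclass a (flip \<eta> p) (flip \<eta> l) (flip \<eta> r) = \<bar>1 - 2 * \<eta>\<bar> * gain misclass a p l r"
  unfolding gain_def misclass_complement flip_centered abs_mult by (simp add: field_simps)

text \<open>The two absolute values agree, and squaring their sum yields a factor 4 that cancels the
  denominator.\<close>

lemma twoing_eq: "twoing a p l r = a * (1 - a) * (l - r)\<^sup>2"
proof -
  have "\<bar>l - r\<bar> + \<bar>(1 - l) - (1 - r)\<bar> = 2 * \<bar>l - r\<bar>"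
    by simp
  then show ?thesis
    by (simp only: twoing_def power_mult_distrib power2_abs) simp
qed

lemma twoing_flip:
  "twoing a (flip \<eta> p) (flip \<eta> l) (flip \<eta> r) = (1 - 2 * \<eta>)\<^sup>2 * twoing a p l r"
proof -
  have "flip \<eta> l - flip \<eta> r = (1 - 2 * \<eta>) * (l - r)"
    by (simp add: flip_def algebra_simps)
  then show ?thesis
    by (simp add: twoing_eq power_mult_distrib)
qed

theorem theorem3:
  fixes M :: "'w measure" and Z :: "nat \<Rightarrow> 'w \<Rightarrow> bool" and \<eta> :: real
    and n :: nat and x :: "nat \<Rightarrow> 'x" and y :: "nat \<Rightarrow> int" and F :: "('x \<Rightarrow> bool) set"
  assumes "n \<ge> 1"
    and "\<And>i. i \<in> {1..n} \<Longrightarrow> y i \<in> {1, -1}"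
    and "0 \<le> \<eta>" and "\<eta> \<le> 1" and "\<eta> \<noteq> 1 / 2"
    and "symmetric_noise M Z {1..n} \<eta>"
  shows "noise_tolerant (gain gini) M Z n x y F
    \<and> noise_tolerant (gain misclass) M Z n x y F
    \<and> noise_tolerant twoing M Z n x y F"
proof -
  note tolerant = noise_tolerant_if_scales[OF assms(1) _ assms(3,4,6)]
  \<comment> \<open>Both factors would vanish at \<open>\<eta> = 1 / 2\<close>.\<close>
  have pos: "(1 - 2 * \<eta>)\<^sup>2 > 0" "\<bar>1 - 2 * \<eta>\<bar> > 0"
    using assms(5) by auto
  show ?thesis
  proof (intro conjI)
    show "noise_tolerant (gain gini) M Z n x y F"
      \<comment> \<open>The goals left to \<open>simp_all\<close> are the conditions at
        \<open>a = 0\<close> and \<open>a = 1\<close>, where the weight of the empty child is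
        zero.\<close>
      by (rule tolerant[OF _ pos(1)]) (erule assms(2), rule gain_gini_flip, simp_all add: gain_def)
    show "noise_tolerant (gain misclass) M Z n x y F"
      by (rule tolerant[OF _ pos(2)]) (erule assms(2), rule gain_misclass_flip, simp_all add: gain_def)
    show "noise_tolerant twoing M Z n x y F"
      by (rule tolerant[OF _ pos(1)]) (erule assms(2), rule twoing_flip, simp_all add: twoing_def)
  qed
qed

end
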